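(* Let $1 \leq p \leq \infty$. The persistence landscape gives a $1$-Lipschitz embedding $$\Lambda: \left(D(\widehat{\mathrm{Int}}(\mathbb{R})_{bco}),\, W_p^{\triangle}\right) \to L^p(\mathbb{N} \times \mathbb{R}), \qquad B \mapsto \Lambda_B;$$ that is, $\Lambda_B \in L^p(\mathbb{N}\times\mathbb{R})$ for every $B \in D(\widehat{\mathrm{Int}}(\mathbb{R})_{bco})$, the map $\Lambda$ is injective, and $\|\Lambda_B - \Lambda_{B'}\|_p \leq W_p^{\triangle}(B,B')$ for all $B,B' \in D(\widehat{\mathrm{Int}}(\mathbb{R})_{bco})$.
   Context: $\widehat{\mathrm{Int}}(\mathbb{R})_{bco}$ is the set of intervals $[b,d) \subseteq \mathbb{R}$ with $-\infty < b < d < \infty$. $D(\widehat{\mathrm{Int}}(\mathbb{R})_{bco})$ is the set of finite formal sums (finite multisets) $\sum_{i=1}^n I_i$, $n\geq 0$, of such intervals (finite barcodes); the empty sum is $0$. For $I$ an interval in $\widehat{\mathrm{Int}}(\mathbb{R})_{bco}$ or $I=\emptyset$, the triangle function $\triangle_I : \mathbb{R} \to [0,\infty)$ is $\triangle_I(t) = \inf_{a \in \mathbb{R}\setminus I} |t-a|$; in particular $\triangle_\emptyset = 0$. Put $d_p(I,J) = \|\triangle_I - \triangle_J\|_p$, the $L^p$ norm for Lebesgue measure on $\mathbb{R}$. The $p$-Wasserstein distance is $$W_p^{\triangle}\Big(\sum_{i=1}^m I_i, \sum_{i=1}^n J_i\Big) = \min_{\sigma \in \Sigma_{m+n}} \left\|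 (d_p(I_i,J_{\sigma(i)}))_{i=1}^{m+n} \right\|_p,$$ where $I_{m+1}=\cdots=I_{m+n}=\emptyset=J_{n+1}=\cdots=J_{n+m}$ and $\Sigma_{m+n}$ is the symmetric group on $\{1,\dots,m+n\}$. It is a metric on $D(\widehat{\mathrm{Int}}(\mathbb{R})_{bco})$. The persistence landscape of $B=\sum_{j=1}^n I_j$ is $\Lambda_B(k,t) = \mathrm{kmax}\,(\triangle_{I_j}(t))_{j=1}^n$ for $k\in\mathbb{N}=\{1,2,\dots\}$, $t\in\mathbb{R}$, where $\mathrm{kmax}\, a$ is the $k$th largest element (with multiplicity) of the finite sequence $a=(a_1,\dots,a_n)$ if $k\leq n$, and $0$ if $k>n$. $\mathbb{N}\times\mathbb{R}$ carries the product of counting measure and Lebesgue measure. *)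

theory Defs
  imports
    "HOL-Probability.Essential_Supremum"
    "HOL-Combinatorics.Permutations"
    "HOL-Library.Multiset"
begin

text \<open>
  The \<open>p\<close>-norm is taken for functions with values in \<open>[0, \<infinity>]\<close> and may be infinite; a real
  function \<open>f\<close> is passed as \<open>\<lambda>x. ennreal \<bar>f x\<bar>\<close>. The clause \<open>x = top\<close> is needed because
  \<^const>\<open>enn2real\<close> sends \<open>\<infinity>\<close> to \<open>0\<close>; the power is used for exponents \<open>r > 0\<close> only.
\<close>

definition ennpowr :: "ennreal \<Rightarrow> real \<Rightarrow> ennreal" where
  "ennpowr x r = (if x = top then top else ennreal (enn2real x powr r))"

definition Lp_norm :: "ennreal \<Rightarrow> 'a measure \<Rightarrow> ('a \<Rightarrow> ennreal) \<Rightarrow> ennreal" where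
  "Lp_norm p M f =
     (if p = top then esssup M f
      else ennpowr (\<integral>\<^sup>+ x. ennpowr (f x) (enn2real p) \<partial>M) (1 / enn2real p))"

definition Lp_functions :: "ennreal \<Rightarrow> 'a measure \<Rightarrow> ('a \<Rightarrow> real) set" where
  "Lp_functions p M = {f \<in> borel_measurable M. Lp_norm p M (\<lambda>x. ennreal \<bar>f x\<bar>) < top}"

text \<open>The element of \<open>L\<^sup>p\<close> represented by \<open>f\<close>, i.e. its class modulo equality almost everywhere.\<close>

definition ae_class :: "'a measure \<Rightarrow> ('a \<Rightarrow> real) \<Rightarrow> ('a \<Rightarrow> real) set" where
  "ae_class M f = {g \<in> borel_measurable M. AE x in M. g x = f x}"

definition Int_bco :: "real set set" where
  "Int_bco = {{b..<d} | b d. b < d}"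

definition barcodes :: "real set multiset set" where
  "barcodes = {B. set_mset B \<subseteq> Int_bco}"

definition triangle :: "real set \<Rightarrow> real \<Rightarrow> real" where
  "triangle I t = (INF a\<in>UNIV - I. \<bar>t - a\<bar>)"

definition interval_dist :: "ennreal \<Rightarrow> real set \<Rightarrow> real set \<Rightarrow> ennreal" where
  "interval_dist p I J = Lp_norm p lborel (\<lambda>t. ennreal \<bar>triangle I t - triangle J t\<bar>)"

text \<open>
  Indices run over \<open>{..<m + n}\<close> instead of \<open>{1..m + n}\<close>. The \<open>p\<close>-norm of a finite tuple is the
  \<open>L\<^sup>p\<close> norm for counting measure on the index set.
\<close>

definition matching_cost ::
  "ennreal \<Rightarrow> real set list \<Rightarrow> real set list \<Rightarrow> (nat \<Rightarrow> nat) \<Rightarrow> ennreal" where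
  "matching_cost p xs ys \<sigma> =
     (let I = xs @ replicate (length ys) {}; J = ys @ replicate (length xs) {}
      in Lp_norm p (count_space {..<length xs + length ys})
           (\<lambda>i. interval_dist p (I ! i) (J ! \<sigma> i)))"

text \<open>
  A formal sum is a multiset, so the minimum also ranges over the ways of listing the summands;
  by \<open>wasserstein_mset\<close> below, any one listing gives the same value.
\<close>

definition wasserstein :: "ennreal \<Rightarrow> real set multiset \<Rightarrow> real set multiset \<Rightarrow> ennreal" where
  "wasserstein p B C =
     Min {matching_cost p xs ys \<sigma> | xs ys \<sigma>.
            mset xs = B \<and> mset ys = C \<and> \<sigma> permutes {..<size B + size C}}"

lemma esssup_count_space: "esssup (count_space A) f = Inf {z. \<forall>x\<in>A. f x \<le> z}"
  by (subst esssup_eq_AE) (auto simp: AE_count_space)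

lemma Lp_norm_count_space_cong:
  assumes "\<And>x. x \<in> A \<Longrightarrow> f x = g x"
  shows "Lp_norm p (count_space A) f = Lp_norm p (count_space A) g"
proof -
  have "(\<forall>x\<in>A. f x \<le> z) \<longleftrightarrow> (\<forall>x\<in>A. g x \<le> z)" for z
    using assms by auto
  moreover have "(\<integral>\<^sup>+ x. ennpowr (f x) r \<partial>count_space A) = (\<integral>\<^sup>+ x. ennpowr (g x) r \<partial>count_space A)" for r
    using assms by (intro nn_integral_cong) auto
  ultimately show ?thesis
    unfolding Lp_norm_def esssup_count_space by simp
qed

lemma Lp_norm_count_space_bij:
  assumes "bij_betw \<pi> A A"
  shows "Lp_norm p (count_space A) (\<lambda>x. f (\<pi> x)) = Lp_norm p (count_space A) f"
proof -
  have "(\<forall>x\<in>A. f (\<pi> x) \<le> z) \<longleftrightarrow> (\<forall>x\<in>A. f x \<le> z)" for z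
    using assms unfolding bij_betw_def by (metis image_eqI imageE)
  then show ?thesis
    unfolding Lp_norm_def esssup_count_space
    by (simp add: nn_integral_bij_count_space[OF assms, of "\<lambda>x. ennpowr (f x) (enn2real p)"])
qed

lemma wasserstein_mset:
  "wasserstein p (mset xs) (mset ys) =
     Min {matching_cost p xs ys \<sigma> | \<sigma>. \<sigma> permutes {..<length xs + length ys}}"
proof -
  let ?A = "{..<length xs + length ys}"
  have *: "\<exists>\<tau>. matching_cost p xs' ys' \<sigma> = matching_cost p xs ys \<tau> \<and> \<tau> permutes ?A"
    if xs: "mset xs' = mset xs" and ys: "mset ys' = mset ys" and \<sigma>: "\<sigma> permutes ?A"
    for xs' ys' \<sigma>
  proof -
    have len: "length xs' = length xs" "length ys' = length ys"
      using xs ys by (metis size_mset)+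
    define I J where "I = xs @ replicate (length ys) {}" and "J = ys @ replicate (length xs) {}"
    have lenIJ: "length I = length xs + length ys" "length J = length xs + length ys"
      by (simp_all add: I_def J_def)
    obtain \<pi> where \<pi>: "\<pi> permutes ?A" "permute_list \<pi> I = xs' @ replicate (length ys) {}"
      using mset_eq_permutation[of "xs' @ replicate (length ys) {}" I] xs lenIJ
      by (auto simp: I_def)
    obtain \<rho> where \<rho>: "\<rho> permutes ?A" "permute_list \<rho> J = ys' @ replicate (length xs) {}"
      using mset_eq_permutation[of "ys' @ replicate (length xs) {}" J] ys lenIJ
      by (auto simp: J_def add.commute)
    define \<tau> where "\<tau> = \<rho> \<circ> \<sigma> \<circ> inv \<pi>"
    have \<tau>: "\<tau> permutes ?A"
      unfolding \<tau>_def by (intro permutes_compose permutes_inv \<pi> \<sigma> \<rho>)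
    let ?f = "\<lambda>j. interval_dist p (I ! j) (J ! \<tau> j)"
    have "matching_cost p xs' ys' \<sigma> =
        Lp_norm p (count_space ?A)
          (\<lambda>i. interval_dist p (permute_list \<pi> I ! i) (permute_list \<rho> J ! \<sigma> i))"
      by (simp add: matching_cost_def Let_def len \<pi> \<rho>)
    also have "\<dots> = Lp_norm p (count_space ?A) (\<lambda>i. ?f (\<pi> i))"
    proof -
      have eq: "interval_dist p (permute_list \<pi> I ! i) (permute_list \<rho> J ! \<sigma> i) = ?f (\<pi> i)"
        if i: "i \<in> ?A" for i
      proof -
        have "\<sigma> i \<in> ?A" using i \<sigma> by (metis permutes_in_image)
        then show ?thesis
          using i \<pi>(1) \<rho>(1) by (simp add: permute_list_nth lenIJ \<tau>_def permutes_inverses)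
      qed
      show ?thesis
        by (rule Lp_norm_count_space_cong) (rule eq)
    qed
    also have "\<dots> = Lp_norm p (count_space ?A) ?f"
      by (intro Lp_norm_count_space_bij permutes_imp_bij \<pi>)
    also have "\<dots> = matching_cost p xs ys \<tau>"
      by (simp add: matching_cost_def Let_def I_def J_def)
    finally show ?thesis using \<tau> by blast
  qed
  have "{matching_cost p xs' ys' \<sigma> | xs' ys' \<sigma>.
           mset xs' = mset xs \<and> mset ys' = mset ys \<and> \<sigma> permutes ?A} =
        {matching_cost p xs ys \<sigma> | \<sigma>. \<sigma> permutes ?A}"
    using * by (auto 0 3)
  then show ?thesis by (simp add: wasserstein_def)
qed

definition kmax :: "nat \<Rightarrow> real multiset \<Rightarrow> real" where
  "kmax k A = (if k \<le> size A then rev (sorted_list_of_multiset A) ! (k - 1) else 0)"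

text \<open>Only the values at \<open>k \<ge> 1\<close> are meaningful; \<open>landscape_measure\<close> lives on \<open>{1..} \<times> UNIV\<close>.\<close>

definition landscape :: "real set multiset \<Rightarrow> nat \<times> real \<Rightarrow> real" where
  "landscape B = (\<lambda>(k, t). kmax k {#triangle I t. I \<in># B#})"

definition landscape_measure :: "(nat \<times> real) measure" where
  "landscape_measure = count_space {1..} \<Otimes>\<^sub>M lborel"

end

theory Submission
  imports Defs
begin

text \<open>
  The inequality rests on a rearrangement principle: for a convex \<open>\<phi>\<close>, pairing two lists of
  numbers in sorted order minimises \<open>\<Sum>i. \<phi> (x i - y i)\<close> over all pairings. It suffices to undo one
  crossing at a time (\<open>convex_four_point\<close>), which is what insertion sort does. Pad the barcodes with
  empty intervals to a common length and fix a matching of them. For each \<open>t\<close> the numbers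
  \<open>\<Lambda> B (k, t)\<close>, \<open>k = 1, 2, \<dots>\<close>, are the values at \<open>t\<close> of the triangle functions of \<open>B\<close> in decreasing
  order, so the landscapes pair the values of \<open>B\<close> and \<open>B'\<close> in sorted order, while the matching pairs
  them in some order. For finite \<open>p\<close>, the principle with \<open>\<phi> u = \<bar>u\<bar> powr p\<close>, integrated over \<open>t\<close>,
  gives \<open>\<parallel>\<Lambda> B - \<Lambda> B'\<parallel>\<^sub>p \<le>\<close> the cost of the matching. For \<open>p = \<infinity>\<close> the maximum replaces the sum, and
  \<open>\<phi> u = max 0 (\<bar>u\<bar> - c)\<close> does the job: its sum vanishes exactly when all differences are at most
  \<open>c\<close>. The same function shows that \<open>\<Lambda> B (k, t)\<close> is continuous in \<open>t\<close>.

  Membership in \<open>L\<^sup>p\<close> is the inequality against the empty barcode, whose landscape is \<open>0\<close> and whose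
  distance to any barcode is finite.

  For injectivity, landscapes that agree almost everywhere agree everywhere, by continuity. For
  \<open>c \<ge> 0\<close>, the number of \<open>k\<close> with \<open>\<Lambda> B (k, t) > c\<close> is the number of intervals in \<open>B\<close> whose triangle function exceeds \<open>c\<close>
  at \<open>t\<close>, and these are the ones whose interior contains \<open>[t - c, t + c]\<close>. Thus \<open>\<Lambda> B\<close> determines, for
  all \<open>s \<le> t\<close>, how many intervals of \<open>B\<close> contain \<open>[s, t]\<close> in their interior (the rank function), and
  inclusion-exclusion with a small shift of the endpoints recovers the multiplicity of \<open>[b, d)\<close>.
\<close>

section \<open>Rearrangement for convex functions\<close>

text \<open>
  The arguments \<open>x - y\<close> and \<open>x' - y'\<close> on the left lie between \<open>x - y'\<close> and \<open>x' - y\<close> and have the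
  same sum, so a convex function has no larger total on them.
\<close>

lemma convex_four_point:
  fixes \<phi> :: "real \<Rightarrow> real"
  assumes \<phi>: "convex_on UNIV \<phi>" and "x \<le> x'" "y \<le> y'"
  shows "\<phi> (x - y) + \<phi> (x' - y') \<le> \<phi> (x - y') + \<phi> (x' - y)"
proof (cases "x - y' = x' - y")
  case True
  with assms have "x = x'" "y = y'" by auto
  then show ?thesis by simp
next
  case False
  define A D where "A = x - y'" and "D = x' - y"
  have AD: "A < D" using False assms by (auto simp: A_def D_def)
  \<comment> \<open>The barycentric coordinate of \<open>x - y\<close> in the segment from \<open>A\<close> to \<open>D\<close>.\<close>
  define l where "l = (x - y - A) / (D - A)"
  have l: "0 \<le> l" "l \<le> 1"
    using AD assms by (auto simp: l_def A_def D_def field_simps)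
  have "l * (D - A) = x - y - A"
    using AD by (simp add: l_def)
  then have pt: "x - y = (1 - l) * A + l * D" "x' - y' = (1 - (1 - l)) * A + (1 - l) * D"
    by (simp_all add: A_def D_def algebra_simps)
  have "\<phi> (x - y) \<le> (1 - l) * \<phi> A + l * \<phi> D"
    unfolding pt(1) using convex_onD[OF \<phi>, of l A D] l by simp
  moreover have "\<phi> (x' - y') \<le> (1 - (1 - l)) * \<phi> A + (1 - l) * \<phi> D"
    unfolding pt(2) using convex_onD[OF \<phi>, of "1 - l" A D] l by simp
  ultimately show ?thesis
    by (simp add: A_def D_def algebra_simps)
qed

text \<open>
  Follow the two insertions from the heads of the lists. If both new elements go further, or both
  stop, nothing happens to the first pair. If one stops and the other goes further, a crossing between
  the new pair and the first pair is undone, and \<open>convex_four_point\<close> pays for it; the element pushed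
  back by the one that stops is then inserted into its tail, which is why the induction hypothesis is
  needed for arbitrary \<open>x\<close> and \<open>y\<close>.
\<close>

lemma sum_insort_le:
  fixes \<phi> :: "real \<Rightarrow> real"
  assumes \<phi>: "convex_on UNIV \<phi>"
    and "length xs = length ys" "sorted xs" "sorted ys"
  shows "(\<Sum>(u, v) \<leftarrow> zip (insort x xs) (insort y ys). \<phi> (u - v))
           \<le> \<phi> (x - y) + (\<Sum>(u, v) \<leftarrow> zip xs ys. \<phi> (u - v))"
  using assms(2-)
proof (induction xs ys arbitrary: x y rule: list_induct2)
  case Nil
  then show ?case by simp
next
  case (Cons x' xs y' ys)
  have IH: "(\<Sum>(u, v) \<leftarrow> zip (insort a xs) (insort b ys). \<phi> (u - v))
              \<le> \<phi> (a - b) + (\<Sum>(u, v) \<leftarrow> zip xs ys. \<phi> (u - v))" for a b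
    using Cons by auto
  have ins: "insort x' xs = x' # xs" "insort y' ys = y' # ys"
    using Cons.prems by (simp_all add: insort_is_Cons)
  consider "x \<le> x'" "y \<le> y'" | "x \<le> x'" "y' < y" | "x' < x" "y \<le> y'" | "x' < x" "y' < y"
    by linarith
  then show ?case
  proof cases
    case 1
    then show ?thesis by simp
  next
    case 2
    then show ?thesis
      using IH[of x' y] convex_four_point[OF \<phi>, of x x' y' y] ins by simp
  next
    case 3
    then show ?thesis
      using IH[of x y'] convex_four_point[OF \<phi>, of x' x y y'] ins by simp
  next
    case 4
    then show ?thesis
      using IH[of x y] by simp
  qed
qed

lemma sum_sort_le:
  fixes \<phi> :: "real \<Rightarrow> real"
  assumes \<phi>: "convex_on UNIV \<phi>" and "length xs = length ys"
  shows "(\<Sum>(u, v) \<leftarrow> zip (sort xs) (sort ys). \<phi> (u - v)) \<le> (\<Sum>(u, v) \<leftarrow> zip xs ys. \<phi> (u - v))"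
  using assms(2)
proof (induction xs ys rule: list_induct2)
  case Nil
  then show ?case by simp
next
  case (Cons x xs y ys)
  then show ?case
    using sum_insort_le[OF \<phi>, of "sort xs" "sort ys" x y] by simp
qed

lemma kmax_rearrangement:
  fixes \<phi> :: "real \<Rightarrow> real"
  assumes \<phi>: "convex_on UNIV \<phi>" and len: "length xs = n" "length ys = n"
  shows "(\<Sum>k\<in>{1..n}. \<phi> (kmax k (mset xs) - kmax k (mset ys))) \<le> (\<Sum>i<n. \<phi> (xs ! i - ys ! i))"
proof -
  have zip: "(\<Sum>(u, v) \<leftarrow> zip us vs. \<phi> (u - v)) = (\<Sum>i<n. \<phi> (us ! i - vs ! i))"
    if "length us = n" "length vs = n" for us vs
    using that by (simp add: sum_list_sum_nth atLeast0LessThan)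
  have "(\<Sum>k\<in>{1..n}. \<phi> (kmax k (mset xs) - kmax k (mset ys)))
      = (\<Sum>k\<in>{1..n}. \<phi> (sort xs ! (n - k) - sort ys ! (n - k)))"
    using len by (intro sum.cong) (auto simp: kmax_def rev_nth Suc_diff_Suc)
  also have "\<dots> = (\<Sum>i<n. \<phi> (sort xs ! i - sort ys ! i))"
    by (rule sum.reindex_bij_witness[of _ "\<lambda>i. n - i" "\<lambda>k. n - k"]) auto
  also have "\<dots> \<le> (\<Sum>i<n. \<phi> (xs ! i - ys ! i))"
    using sum_sort_le[OF \<phi>, of xs ys] zip[of xs ys] zip[of "sort xs" "sort ys"] len by simp
  finally show ?thesis .
qed

lemma convex_on_excess: "convex_on UNIV (\<lambda>u::real. max 0 (\<bar>u\<bar> - c))"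
proof (rule convex_onI)
  fix t x y :: real
  assume t: "0 < t" "t < 1"
  have "\<bar>(1 - t) * x + t * y\<bar> - c \<le> (1 - t) * (\<bar>x\<bar> - c) + t * (\<bar>y\<bar> - c)"
  proof -
    have "\<bar>(1 - t) * x + t * y\<bar> \<le> (1 - t) * \<bar>x\<bar> + t * \<bar>y\<bar>"
      using t abs_triangle_ineq[of "(1 - t) * x" "t * y"] by (simp add: abs_mult)
    then show ?thesis by (simp add: algebra_simps)
  qed
  also have "\<dots> \<le> (1 - t) * max 0 (\<bar>x\<bar> - c) + t * max 0 (\<bar>y\<bar> - c)"
    using t by (intro add_mono mult_left_mono) auto
  finally show "max 0 (\<bar>(1 - t) *\<^sub>R x + t *\<^sub>R y\<bar> - c)
      \<le> (1 - t) * max 0 (\<bar>x\<bar> - c) + t * max 0 (\<bar>y\<bar> - c)"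
    using t by simp
qed simp

lemma convex_on_abs_powr:
  assumes r: "1 \<le> r"
  shows "convex_on UNIV (\<lambda>u::real. \<bar>u\<bar> powr r)"
proof (rule convex_onI)
  fix t x y :: real
  assume t: "0 < t" "t < 1"
  \<comment> \<open>Convexity of \<open>powr\<close> covers positive arguments only; this settles the case of a zero argument.\<close>
  have le: "s powr r \<le> s" if "0 < s" "s < 1" for s :: real
    using powr_mono'[of 1 r s] that r by simp
  have "\<bar>(1 - t) * x + t * y\<bar> powr r \<le> ((1 - t) * \<bar>x\<bar> + t * \<bar>y\<bar>) powr r"
    using t r abs_triangle_ineq[of "(1 - t) * x" "t * y"]
    by (intro powr_mono2) (auto simp: abs_mult)
  also have "\<dots> \<le> (1 - t) * \<bar>x\<bar> powr r + t * \<bar>y\<bar> powr r"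
  proof (cases "x = 0 \<or> y = 0")
    case True
    then show ?thesis
      using t le[of t] le[of "1 - t"] by (auto simp: powr_mult intro!: mult_right_mono)
  next
    case False
    then show ?thesis
      using convex_onD[OF powr_convex[OF r], of t "\<bar>x\<bar>" "\<bar>y\<bar>"] t by simp
  qed
  finally show "\<bar>(1 - t) *\<^sub>R x + t *\<^sub>R y\<bar> powr r \<le> (1 - t) * \<bar>x\<bar> powr r + t * \<bar>y\<bar> powr r"
    by simp
qed simp

section \<open>The \<open>k\<close>th largest element\<close>

text \<open>
  The supremum analogue of \<open>kmax_rearrangement\<close>, obtained from it with the excess over \<open>c\<close> as the
  convex function: all excesses on the right vanish, hence so do those on the left.
\<close>

lemma kmax_close:
  assumes len: "length xs = n" "length ys = n"
    and le: "\<And>i. i < n \<Longrightarrow> \<bar>xs ! i - ys ! i\<bar> \<le> c" and "0 \<le> c" "1 \<le> k"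
  shows "\<bar>kmax k (mset xs) - kmax k (mset ys)\<bar> \<le> c"
proof (cases "k \<le> n")
  case True
  let ?\<phi> = "\<lambda>u::real. max 0 (\<bar>u\<bar> - c)"
  let ?d = "\<lambda>k. kmax k (mset xs) - kmax k (mset ys)"
  have "?\<phi> (?d k) \<le> (\<Sum>k\<in>{1..n}. ?\<phi> (?d k))"
    using True \<open>1 \<le> k\<close> by (intro member_le_sum) auto
  also have "\<dots> \<le> (\<Sum>i<n. ?\<phi> (xs ! i - ys ! i))"
    by (rule kmax_rearrangement[OF convex_on_excess len])
  also have "\<dots> = 0"
    using le by (intro sum.neutral) force
  finally show ?thesis by simp
next
  case False
  then show ?thesis using len \<open>0 \<le> c\<close> by (simp add: kmax_def)
qed

lemma kmax_pad:
  assumes "\<And>x. x \<in> set xs \<Longrightarrow> 0 \<le> x" and "1 \<le> k"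
  shows "kmax k (mset (xs @ replicate n 0)) = kmax k (mset xs)"
proof -
  have "sort (xs @ replicate n 0) = replicate n 0 @ sort xs"
    by (rule properties_for_sort) (use assms in \<open>auto simp: sorted_append ac_simps\<close>)
  then show ?thesis
    using \<open>1 \<le> k\<close> by (auto simp: kmax_def nth_append simp del: mset_append mset_replicate)
qed

text \<open>
  This is how the landscape is read as a family of counts: it recovers the number of elements above
  every nonnegative level. The bound \<open>0 \<le> c\<close> makes the value \<open>0\<close> for \<open>k > size A\<close> harmless.
\<close>

lemma kmax_gt_iff:
  assumes "0 \<le> c" and k: "1 \<le> k"
  shows "c < kmax k A \<longleftrightarrow> k \<le> size {#x \<in># A. c < x#}"
proof -
  have desc: "i < length (filter (\<lambda>x. c < x) zs) \<longleftrightarrow> i < length zs \<and> c < zs ! i"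
    if "sorted_wrt (\<ge>) zs" for zs i
    using that
  proof (induction zs arbitrary: i)
    case (Cons z zs)
    show ?case
    proof (cases "c < z")
      case True
      then show ?thesis using Cons by (cases i) auto
    next
      case False
      with Cons.prems have "\<forall>x\<in>set (z # zs). \<not> c < x" by auto
      then show ?thesis
        by (metis filter_False length_greater_0_conv less_nat_zero_code list.size(3) nth_mem)
    qed
  qed simp
  define zs where "zs = rev (sorted_list_of_multiset A)"
  have zs: "mset zs = A" "sorted_wrt (\<ge>) zs"
    by (simp_all add: zs_def sorted_wrt_rev)
  have "size {#x \<in># A. c < x#} = length (filter (\<lambda>x. c < x) zs)"
    by (metis mset_filter size_mset zs(1))
  moreover have "size A = length zs"
    using zs(1) by (metis size_mset)
  ultimately show ?thesis
    using desc[OF zs(2), of "k - 1"] assms by (auto simp: kmax_def zs_def)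
qed

section \<open>Triangle functions\<close>

text \<open>
  The identification with a distance function brings in nonnegativity and the Lipschitz property.
  The set \<open>UNIV\<close> is excluded because its infimum is taken over the empty set.
\<close>

lemma triangle_infdist:
  assumes "I \<noteq> UNIV"
  shows "triangle I t = infdist t (- I)"
proof -
  have "- I \<noteq> {}" using assms by auto
  then show ?thesis by (simp add: triangle_def infdist_def dist_real_def Compl_eq_Diff_UNIV)
qed

lemma triangle_eq_0: "I \<noteq> UNIV \<Longrightarrow> t \<notin> I \<Longrightarrow> triangle I t = 0"
  by (simp add: triangle_infdist)

lemma triangle_empty [simp]: "triangle {} t = 0"
  by (simp add: triangle_eq_0)

lemma bco_neq_UNIV: "I \<in> insert {} Int_bco \<Longrightarrow> I \<noteq> UNIV"
proof -
  assume "I \<in> insert {} Int_bco"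
  then obtain b d where "I = {} \<or> I = {b..<d}" by (auto simp: Int_bco_def)
  then have "d \<notin> I" by auto
  then show ?thesis by blast
qed

lemma triangle_nonneg: "I \<noteq> UNIV \<Longrightarrow> 0 \<le> triangle I t"
  by (simp add: triangle_infdist infdist_nonneg)

lemma triangle_lipschitz: "I \<noteq> UNIV \<Longrightarrow> \<bar>triangle I s - triangle I t\<bar> \<le> \<bar>s - t\<bar>"
  using infdist_triangle_abs[of s "- I" t] by (simp add: triangle_infdist dist_real_def)

lemma measurable_triangle [measurable]:
  assumes "I \<noteq> UNIV"
  shows "triangle I \<in> borel_measurable borel"
proof -
  have "triangle I = (\<lambda>t. infdist t (- I))"
    using triangle_infdist[OF assms] by blast
  then show ?thesis
    by (auto intro!: borel_measurable_continuous_onI continuous_intros)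
qed

text \<open>
  Informally, \<open>triangle I t\<close> is the radius of the largest interval with centre \<open>t\<close> inside \<open>I\<close>. The
  interior appears because the inequality on the left is strict.
\<close>

lemma triangle_gt_iff:
  assumes "I \<in> Int_bco" and "0 \<le> c"
  shows "c < triangle I t \<longleftrightarrow> {t - c..t + c} \<subseteq> interior I"
proof -
  obtain b d where I: "I = {b..<d}" and "b < d"
    using assms(1) by (auto simp: Int_bco_def)
  have ne: "I \<noteq> UNIV" using assms(1) bco_neq_UNIV by blast
  have up: "triangle I t \<le> \<bar>t - a\<bar>" if "a \<notin> I" for a
    using that ne infdist_le[of a "- I" t] by (simp add: triangle_infdist dist_real_def)
  show ?thesis
  proof
    assume c: "c < triangle I t"
    then have t: "b \<le> t" "t < d"
      using up[of t] \<open>0 \<le> c\<close> by (auto simp: I)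
    have "c < t - b"
    proof -
      \<comment> \<open>The endpoint \<open>b\<close> belongs to \<open>I\<close>, so it is approached by points outside.\<close>
      have "triangle I t \<le> (t - b) + e" if "0 < e" for e
        using up[of "b - e"] t that by (simp add: I)
      then have "triangle I t \<le> t - b" by (rule field_le_epsilon)
      then show ?thesis using c by simp
    qed
    moreover have "c < d - t"
      using c up[of d] t by (simp add: I)
    ultimately show "{t - c..t + c} \<subseteq> interior I"
      by (auto simp: I)
  next
    assume "{t - c..t + c} \<subseteq> interior I"
    then have "b < t - c" "t + c < d"
      using \<open>0 \<le> c\<close> by (auto simp: I subset_iff)
    moreover have "min (t - b) (d - t) \<le> triangle I t"
      unfolding triangle_def using ne
      by (intro cINF_greatest) (auto simp: I)
    ultimately show "c < triangle I t" by linarith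
  qed
qed

section \<open>Regularity of the landscape\<close>

text \<open>
  Both barcodes of a matching are padded to a common length by empty intervals, in an order that the
  matching prescribes; the landscape sees neither the padding nor the order.
\<close>

lemma landscape_eq_kmax_padded:
  assumes "B \<in> barcodes" and us: "mset us = B + replicate_mset n {}" and "1 \<le> k"
  shows "landscape B (k, t) = kmax k (mset (map (\<lambda>I. triangle I t) us))"
proof -
  obtain xs where xs: "B = mset xs" by (metis ex_mset)
  have nonneg: "0 \<le> x" if "x \<in> set (map (\<lambda>I. triangle I t) xs)" for x
    using that assms(1) by (auto simp: barcodes_def xs intro!: triangle_nonneg bco_neq_UNIV)
  have "mset (map (\<lambda>I. triangle I t) us) = mset (map (\<lambda>I. triangle I t) xs @ replicate n 0)"
    by (simp add: us xs)
  then show ?thesis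
    using kmax_pad[of "map (\<lambda>I. triangle I t) xs" k n] nonneg \<open>1 \<le> k\<close>
    by (simp add: landscape_def xs del: mset_append)
qed

lemma landscape_vanish: "size B < k \<Longrightarrow> landscape B (k, t) = 0"
  by (simp add: landscape_def kmax_def)

lemma landscape_lipschitz:
  assumes "B \<in> barcodes" and k: "1 \<le> k"
  shows "\<bar>landscape B (k, s) - landscape B (k, t)\<bar> \<le> \<bar>s - t\<bar>"
proof -
  obtain xs where xs: "B = mset xs" by (metis ex_mset)
  have "set xs \<subseteq> Int_bco" using assms by (auto simp: barcodes_def xs)
  then have "\<bar>kmax k (mset (map (\<lambda>I. triangle I s) xs)) - kmax k (mset (map (\<lambda>I. triangle I t) xs))\<bar>
      \<le> \<bar>s - t\<bar>"
    using k by (intro kmax_close[of _ "length xs"])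
      (auto intro!: triangle_lipschitz bco_neq_UNIV dest: nth_mem)
  then show ?thesis by (simp add: landscape_def xs)
qed

lemma continuous_landscape:
  assumes "B \<in> barcodes" "1 \<le> k"
  shows "continuous_on UNIV (\<lambda>t. landscape B (k, t))"
  unfolding continuous_on_iff dist_real_def
  using landscape_lipschitz[OF assms] by (meson le_less_trans)

lemma measurable_landscape [measurable]:
  assumes "B \<in> barcodes"
  shows "landscape B \<in> borel_measurable landscape_measure"
  unfolding landscape_measure_def
  by (intro measurable_pair_measure_countable1)
     (auto intro!: borel_measurable_continuous_onI continuous_landscape assms)

section \<open>Stability\<close>

text \<open>
  The matching is encoded by the order of the lists: the \<open>i\<close>th entries of \<open>us\<close> and \<open>vs\<close> are
  matched. Pointwise in \<open>t\<close>, the claim is \<open>kmax_rearrangement\<close> for finite \<open>p\<close> and \<open>kmax_close\<close> for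
  \<open>p = \<infinity>\<close>; Tonelli and its analogue for null sets carry it over to the product measure.
\<close>

lemma landscape_Lp_le_pairing_cost:
  assumes p: "1 \<le> p" and B: "B \<in> barcodes" and C: "C \<in> barcodes"
    and us: "mset us = B + replicate_mset m {}" and vs: "mset vs = C + replicate_mset n {}"
    and len: "length us = N" "length vs = N"
  shows "Lp_norm p landscape_measure (\<lambda>x. ennreal \<bar>landscape B x - landscape C x\<bar>)
           \<le> Lp_norm p (count_space {..<N}) (\<lambda>i. interval_dist p (us ! i) (vs ! i))"
proof -
  let ?D = "\<lambda>x. landscape B x - landscape C x"
  let ?\<Delta> = "\<lambda>i t. triangle (us ! i) t - triangle (vs ! i) t"
  interpret P: pair_sigma_finite "count_space {1::nat..}" "lborel :: real measure"
    by (intro pair_sigma_finite.intro sigma_finite_measure_count_space_countable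
        sigma_finite_lborel) auto
  note kmax = landscape_eq_kmax_padded[OF B us] landscape_eq_kmax_padded[OF C vs]
  have size: "size B \<le> N" "size C \<le> N"
    using us vs len by (metis le_add1 size_mset size_union)+
  note [measurable] = measurable_landscape[OF B] measurable_landscape[OF C]
  have "I \<in> insert {} Int_bco" if "I \<in> set us \<union> set vs" for I
    using that B C arg_cong[OF us, of set_mset] arg_cong[OF vs, of set_mset]
    by (auto simp: barcodes_def split: if_splits)
  then have [measurable]: "triangle (us ! i) \<in> borel_measurable borel"
      "triangle (vs ! i) \<in> borel_measurable borel" if "i < N" for i
    using that len by (simp_all add: measurable_triangle bco_neq_UNIV)
  show ?thesis
  proof (cases "p = top")
    case True
    have "esssup landscape_measure (\<lambda>x. ennreal \<bar>?D x\<bar>) \<le> z"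
      if z: "\<forall>i<N. esssup lborel (\<lambda>t. ennreal \<bar>?\<Delta> i t\<bar>) \<le> z" for z
    proof (rule esssup_I)
      have "AE t in lborel. \<forall>i\<in>{..<N}. ennreal \<bar>?\<Delta> i t\<bar> \<le> z"
      proof (rule AE_finite_allI)
        fix i assume "i \<in> {..<N}"
        then show "AE t in lborel. ennreal \<bar>?\<Delta> i t\<bar> \<le> z"
          using esssup_AE[of "\<lambda>t. ennreal \<bar>?\<Delta> i t\<bar>" lborel] z by (auto elim!: eventually_mono)
      qed simp
      then have ae: "AE t in lborel. \<forall>k\<ge>1. ennreal \<bar>?D (k, t)\<bar> \<le> z"
      proof eventually_elim
        case (elim t)
        show ?case
        proof (cases z)
          case (real c)
          with elim have "\<bar>?\<Delta> i t\<bar> \<le> c" if "i < N" for i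
            using that by auto
          then have "\<bar>?D (k, t)\<bar> \<le> c" if "1 \<le> k" for k
            unfolding kmax[OF that] using real that len
            by (intro kmax_close[of _ N]) auto
          then show ?thesis using real by (simp add: ennreal_leI)
        qed simp
      qed
      have meas: "{x \<in> space (count_space {1..} \<Otimes>\<^sub>M lborel). ennreal \<bar>?D x\<bar> \<le> z}
          \<in> sets (count_space {1..} \<Otimes>\<^sub>M lborel)"
        unfolding landscape_measure_def[symmetric] by measurable
      have "AE x in count_space {1..} \<Otimes>\<^sub>M lborel. ennreal \<bar>?D x\<bar> \<le> z"
        by (rule P.AE_pair_measure[OF meas])
           (use ae in \<open>auto simp: AE_count_space elim!: eventually_mono\<close>)
      then show "AE x in landscape_measure. ennreal \<bar>?D x\<bar> \<le> z"
        unfolding landscape_measure_def .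
    qed simp
    then show ?thesis
      by (auto simp: True Lp_norm_def interval_dist_def esssup_count_space intro!: Inf_greatest)
  next
    case False
    define r where "r = enn2real p"
    have r: "1 \<le> r"
      using p False unfolding r_def
      by (metis enn2real_1 enn2real_mono top.not_eq_extremum)
    have pw: "ennpowr (ennreal \<bar>u\<bar>) r = ennreal (\<bar>u\<bar> powr r)" for u
      by (simp add: ennpowr_def)
    have cancel: "ennpowr (ennpowr x (1 / r)) r = x" for x
      using r by (cases x) (auto simp: ennpowr_def powr_powr)
    have mono: "ennpowr x (1 / r) \<le> ennpowr y (1 / r)" if "x \<le> y" for x y
      using r that by (cases x; cases y)
        (auto simp: ennpowr_def top_unique intro!: ennreal_leI powr_mono2)
    have "(\<integral>\<^sup>+ x. ennreal (\<bar>?D x\<bar> powr r) \<partial>landscape_measure)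
        = (\<integral>\<^sup>+ t. \<integral>\<^sup>+ k. ennreal (\<bar>?D (k, t)\<bar> powr r) \<partial>count_space {1..} \<partial>lborel)"
      unfolding landscape_measure_def
      by (rule P.nn_integral_snd[symmetric], unfold landscape_measure_def[symmetric]) measurable
    also have "\<dots> = (\<integral>\<^sup>+ t. ennreal (\<Sum>k\<in>{1..N}. \<bar>?D (k, t)\<bar> powr r) \<partial>lborel)"
    proof (rule nn_integral_cong)
      fix t
      have "(\<integral>\<^sup>+ k. ennreal (\<bar>?D (k, t)\<bar> powr r) \<partial>count_space {1..})
          = (\<Sum>k\<in>{1..N}. ennreal (\<bar>?D (k, t)\<bar> powr r))"
        by (rule nn_integral_count_space') (use size in \<open>auto simp: landscape_vanish\<close>)
      then show "(\<integral>\<^sup>+ k. ennreal (\<bar>?D (k, t)\<bar> powr r) \<partial>count_space {1..})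
          = ennreal (\<Sum>k\<in>{1..N}. \<bar>?D (k, t)\<bar> powr r)"
        by (simp add: sum_ennreal)
    qed
    also have "\<dots> \<le> (\<integral>\<^sup>+ t. ennreal (\<Sum>i<N. \<bar>?\<Delta> i t\<bar> powr r) \<partial>lborel)"
    proof (intro nn_integral_mono ennreal_leI)
      fix t
      show "(\<Sum>k\<in>{1..N}. \<bar>?D (k, t)\<bar> powr r) \<le> (\<Sum>i<N. \<bar>?\<Delta> i t\<bar> powr r)"
        using kmax_rearrangement[OF convex_on_abs_powr[OF r],
            of "map (\<lambda>I. triangle I t) us" N "map (\<lambda>I. triangle I t) vs"] len
        by (simp add: kmax)
    qed
    also have "\<dots> = (\<Sum>i<N. \<integral>\<^sup>+ t. ennreal (\<bar>?\<Delta> i t\<bar> powr r) \<partial>lborel)"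
      by (subst nn_integral_sum[symmetric]) (auto simp: sum_ennreal intro!: nn_integral_cong)
    finally show ?thesis
      using False
      by (simp add: Lp_norm_def interval_dist_def r_def[symmetric] pw cancel
          nn_integral_count_space_finite mono)
  qed
qed

lemma landscape_Lp_le_matching_cost:
  assumes p: "1 \<le> p" and B: "mset xs \<in> barcodes" and C: "mset ys \<in> barcodes"
    and \<sigma>: "\<sigma> permutes {..<length xs + length ys}"
  shows "Lp_norm p landscape_measure (\<lambda>x. ennreal \<bar>landscape (mset xs) x - landscape (mset ys) x\<bar>)
           \<le> matching_cost p xs ys \<sigma>"
proof -
  let ?N = "length xs + length ys"
  let ?I = "xs @ replicate (length ys) {}" and ?J = "ys @ replicate (length xs) {}"
  have \<sigma>': "\<sigma> permutes {..<length ?J}"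
    using \<sigma> by (simp add: add.commute)
  have "Lp_norm p landscape_measure (\<lambda>x. ennreal \<bar>landscape (mset xs) x - landscape (mset ys) x\<bar>)
      \<le> Lp_norm p (count_space {..<?N}) (\<lambda>i. interval_dist p (?I ! i) (permute_list \<sigma> ?J ! i))"
    using mset_permute_list[OF \<sigma>']
    by (intro landscape_Lp_le_pairing_cost[OF p B C]) auto
  also have "\<dots> = matching_cost p xs ys \<sigma>"
    unfolding matching_cost_def Let_def
    by (rule Lp_norm_count_space_cong) (simp add: permute_list_nth[OF \<sigma>'])
  finally show ?thesis .
qed

lemma wasserstein_attained:
  obtains xs ys \<sigma> where "mset xs = B" "mset ys = C" "\<sigma> permutes {..<length xs + length ys}"
    "wasserstein p B C = matching_cost p xs ys \<sigma>"
proof -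
  obtain xs ys where xy: "mset xs = B" "mset ys = C" by (metis ex_mset)
  let ?P = "{\<sigma>. \<sigma> permutes {..<length xs + length ys}}"
  have "{matching_cost p xs ys \<sigma> | \<sigma>. \<sigma> permutes {..<length xs + length ys}}
      = matching_cost p xs ys ` ?P" by auto
  then have "wasserstein p B C = Min (matching_cost p xs ys ` ?P)"
    using wasserstein_mset[of p xs ys] xy by simp
  moreover have "Min (matching_cost p xs ys ` ?P) \<in> matching_cost p xs ys ` ?P"
    by (rule Min_in) (auto intro: finite_permutations permutes_id)
  ultimately obtain \<sigma> where "\<sigma> permutes {..<length xs + length ys}"
    "wasserstein p B C = matching_cost p xs ys \<sigma>"
    by auto
  with xy show thesis by (rule that)
qed

lemma landscape_lipschitz_wasserstein:
  assumes "1 \<le> p" "B \<in> barcodes" "C \<in> barcodes"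
  shows "Lp_norm p landscape_measure (\<lambda>x. ennreal \<bar>landscape B x - landscape C x\<bar>)
           \<le> wasserstein p B C"
proof -
  obtain xs ys \<sigma> where *: "mset xs = B" "mset ys = C" "\<sigma> permutes {..<length xs + length ys}"
    "wasserstein p B C = matching_cost p xs ys \<sigma>"
    by (rule wasserstein_attained)
  show ?thesis
    using landscape_Lp_le_matching_cost[OF assms(1), of xs ys \<sigma>] assms(2,3) *(3)
    unfolding *(1,2,4) by simp
qed

section \<open>Membership in \<open>L\<^sup>p\<close>\<close>

text \<open>
  A triangle function is bounded, with support in a bounded interval.
\<close>

lemma interval_dist_empty_finite:
  assumes p: "1 \<le> p" and I: "I \<in> insert {} Int_bco"
  shows "interval_dist p I {} < top"
proof -
  note [measurable] = measurable_triangle[OF bco_neq_UNIV[OF I]]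
  note nonneg = triangle_nonneg[OF bco_neq_UNIV[OF I]]
  note zero = triangle_eq_0[OF bco_neq_UNIV[OF I]]
  obtain b d where bd: "b < d" "I \<subseteq> {b..<d}"
  proof (cases "I = {}")
    case True
    then show thesis using that[of 0 1] by simp
  next
    case False
    then show thesis using that I by (auto simp: Int_bco_def)
  qed
  have bound: "triangle I t \<le> d - b" for t
  proof (cases "t \<in> I")
    case True
    have "d \<notin> I" using bd by auto
    then have "triangle I t \<le> \<bar>t - d\<bar>"
      using triangle_lipschitz[OF bco_neq_UNIV[OF I], of t d] zero[of d] by simp
    moreover have "b \<le> t" "t < d" using True bd by auto
    ultimately show ?thesis by simp
  qed (use zero bd in simp)
  show ?thesis
  proof (cases "p = top")
    case True
    have "esssup lborel (\<lambda>t. ennreal \<bar>triangle I t\<bar>) \<le> ennreal (d - b)"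
      using bound nonneg by (intro esssup_I) (auto intro!: ennreal_leI)
    then show ?thesis
      using True by (simp add: interval_dist_def Lp_norm_def le_less_trans)
  next
    case False
    have "(\<integral>\<^sup>+ t. ennpowr (ennreal \<bar>triangle I t\<bar>) (enn2real p) \<partial>lborel)
        \<le> (\<integral>\<^sup>+ t. ennreal ((d - b) powr enn2real p) * indicator {b..d} t \<partial>lborel)"
    proof (rule nn_integral_mono)
      fix t
      show "ennpowr (ennreal \<bar>triangle I t\<bar>) (enn2real p)
          \<le> ennreal ((d - b) powr enn2real p) * indicator {b..d} t"
      proof (cases "t \<in> I")
        case True
        then have "t \<in> {b..d}" using bd by auto
        moreover have "triangle I t powr enn2real p \<le> (d - b) powr enn2real p"
          using bound nonneg by (intro powr_mono2) auto
        ultimately show ?thesis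
          using nonneg[of t] by (simp add: ennpowr_def ennreal_leI)
      qed (simp add: zero ennpowr_def)
    qed
    also have "\<dots> < top"
      using bd by (simp add: nn_integral_cmult_indicator ennreal_mult_less_top)
    finally show ?thesis
      using False by (simp add: interval_dist_def Lp_norm_def ennpowr_def)
  qed
qed

lemma wasserstein_empty_finite:
  assumes p: "1 \<le> p" and B: "B \<in> barcodes"
  shows "wasserstein p B {#} < top"
proof -
  obtain xs ys \<sigma> where *: "mset xs = B" "mset ys = {#}" "\<sigma> permutes {..<length xs + length ys}"
    "wasserstein p B {#} = matching_cost p xs ys \<sigma>"
    by (rule wasserstein_attained)
  then have ys: "ys = []" by simp
  define n where "n = length xs"
  have \<sigma>: "\<sigma> i < n" if "i < n" for i
    using that *(3) ys n_def by (metis add.right_neutral lessThan_iff list.size(3) permutes_in_image)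
  have "matching_cost p xs ys \<sigma>
      = Lp_norm p (count_space {..<n}) (\<lambda>i. interval_dist p (xs ! i) (replicate n {} ! \<sigma> i))"
    by (simp add: matching_cost_def ys n_def)
  also have "\<dots> = Lp_norm p (count_space {..<n}) (\<lambda>i. interval_dist p (xs ! i) {})"
    by (rule Lp_norm_count_space_cong) (simp add: \<sigma>)
  also have "\<dots> < top"
  proof -
    have fin: "interval_dist p (xs ! i) {} < top" if "i < n" for i
    proof (rule interval_dist_empty_finite[OF p])
      have "xs ! i \<in># B" using that *(1) by (auto simp: n_def)
      then show "xs ! i \<in> insert {} Int_bco" using B by (auto simp: barcodes_def)
    qed
    show ?thesis
    proof (cases "p = top")
      case True
      have "Inf {z. \<forall>i\<in>{..<n}. interval_dist p (xs ! i) {} \<le> z} \<le> (\<Sum>i<n. interval_dist p (xs ! i) {})"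
        by (rule Inf_lower) (auto intro!: member_le_sum)
      also have "\<dots> < top" using fin by (simp add: less_top)
      finally show ?thesis using True by (simp add: Lp_norm_def esssup_count_space)
    next
      case False
      then show ?thesis
        using fin by (auto simp: Lp_norm_def nn_integral_count_space_finite ennpowr_def less_top)
    qed
  qed
  finally show ?thesis using * by simp
qed

text \<open>
  The norm of \<open>landscape B\<close> is its distance to the landscape of the empty barcode, which is zero on
  the points with \<open>k \<ge> 1\<close>; stability bounds that distance by the finite
  \<open>wasserstein p B {#}\<close>.
\<close>

lemma landscape_in_Lp:
  assumes p: "1 \<le> p" and B: "B \<in> barcodes"
  shows "landscape B \<in> Lp_functions p landscape_measure"
proof -
  have E: "{#} \<in> barcodes" by (simp add: barcodes_def)
  note [measurable] = measurable_landscape[OF B] measurable_landscape[OF E]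
  have zero: "landscape {#} x = 0" if "x \<in> space landscape_measure" for x
    using that by (cases x) (auto simp: landscape_measure_def space_pair_measure intro!: landscape_vanish)
  have "Lp_norm p landscape_measure (\<lambda>x. ennreal \<bar>landscape B x - landscape {#} x\<bar>)
      = Lp_norm p landscape_measure (\<lambda>x. ennreal \<bar>landscape B x\<bar>)"
  proof -
    have "esssup landscape_measure (\<lambda>x. ennreal \<bar>landscape B x - landscape {#} x\<bar>)
        = esssup landscape_measure (\<lambda>x. ennreal \<bar>landscape B x\<bar>)"
      by (rule esssup_AE_cong) (auto simp: zero intro!: AE_I2)
    moreover have "(\<integral>\<^sup>+ x. ennpowr (ennreal \<bar>landscape B x - landscape {#} x\<bar>) r \<partial>landscape_measure)
        = (\<integral>\<^sup>+ x. ennpowr (ennreal \<bar>landscape B x\<bar>) r \<partial>landscape_measure)" for r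
      by (rule nn_integral_cong) (simp add: zero)
    ultimately show ?thesis by (simp add: Lp_norm_def)
  qed
  then have "Lp_norm p landscape_measure (\<lambda>x. ennreal \<bar>landscape B x\<bar>) < top"
    using landscape_lipschitz_wasserstein[OF p B E] wasserstein_empty_finite[OF p B] by simp
  then show ?thesis by (simp add: Lp_functions_def)
qed

section \<open>Injectivity\<close>

text \<open>
  The rank function of persistence theory, except that both endpoint conditions are strict (hence the
  interior), in accordance with \<open>triangle_gt_iff\<close>.
\<close>

definition barcode_rank :: "real set multiset \<Rightarrow> real \<Rightarrow> real \<Rightarrow> nat" where
  "barcode_rank B s t = size {#I \<in># B. {s..t} \<subseteq> interior I#}"

text \<open>
  A closed interval \<open>{s..t}\<close> is the ball of radius \<open>(t - s) / 2\<close> around its midpoint, so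
  \<open>barcode_rank B s t\<close> counts the triangle functions that exceed \<open>(t - s) / 2\<close> there.
\<close>

lemma rank_eq_if_landscape_eq:
  assumes B: "B \<in> barcodes" and C: "C \<in> barcodes" and st: "s \<le> t"
    and eq: "\<And>k t. 1 \<le> k \<Longrightarrow> landscape B (k, t) = landscape C (k, t)"
  shows "barcode_rank B s t = barcode_rank C s t"
proof -
  have *: "k \<le> barcode_rank A s t \<longleftrightarrow> (t - s) / 2 < landscape A (k, (s + t) / 2)"
    if "A \<in> barcodes" "1 \<le> k" for A k
  proof -
    let ?c = "(t - s) / 2" and ?m = "(s + t) / 2"
    have ivl: "?m - ?c = s" "?m + ?c = t" by (simp_all add: field_simps)
    have "barcode_rank A s t = size {#I \<in># A. ?c < triangle I ?m#}"
      unfolding barcode_rank_def using that st triangle_gt_iff[of _ ?c ?m]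
      by (intro arg_cong[of _ _ size] filter_mset_cong) (auto simp: barcodes_def ivl)
    also have "\<dots> = size {#x \<in># {#triangle I ?m. I \<in># A#}. ?c < x#}"
      by (simp add: filter_mset_image_mset)
    finally show ?thesis
      using kmax_gt_iff[of ?c k "{#triangle I ?m. I \<in># A#}"] that st by (simp add: landscape_def)
  qed
  have "k \<le> barcode_rank B s t \<longleftrightarrow> k \<le> barcode_rank C s t" for k
    using *[OF B, of k] *[OF C, of k] eq[of k] by (cases "1 \<le> k") auto
  then show ?thesis by (meson order_antisym order_refl)
qed

text \<open>
  Inclusion-exclusion: the alternating sum of the four ranks counts the intervals \<open>[b', d')\<close> with
  \<open>b \<le> b' < b + e\<close> and \<open>d - e < d' \<le> d\<close>. By the gap hypotheses, the only such interval is \<open>[b, d)\<close>. The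
  terms are arranged on the two sides so that no subtraction of natural numbers occurs.
\<close>

lemma count_rank:
  assumes "B \<in> barcodes" and "0 < e"
    and b: "\<And>I. I \<in># B \<Longrightarrow> Inf I \<le> b \<or> b + e \<le> Inf I"
    and d: "\<And>I. I \<in># B \<Longrightarrow> Sup I \<le> d - e \<or> d \<le> Sup I"
    and bd: "b + e \<le> d - e"
  shows "count B {b..<d} + barcode_rank B b (d - e) + barcode_rank B (b + e) d
           = barcode_rank B (b + e) (d - e) + barcode_rank B b d"
  using assms(1) b d
proof (induction B)
  case empty
  then show ?case by (simp add: barcode_rank_def)
next
  case (add I B)
  obtain b' d' where I: "I = {b'..<d'}" and bd': "b' < d'"
    using add.prems(1) by (auto simp: barcodes_def Int_bco_def)
  have "Inf I = b'" "Sup I = d'" using bd' by (simp_all add: I)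
  then have gap: "b' \<le> b \<or> b + e \<le> b'" "d' \<le> d - e \<or> d \<le> d'"
    using add.prems(2,3)[of I] by auto
  have IH: "count B {b..<d} + barcode_rank B b (d - e) + barcode_rank B (b + e) d
      = barcode_rank B (b + e) (d - e) + barcode_rank B b d"
    using add by (auto simp: barcodes_def)
  have eq: "I = {b..<d} \<longleftrightarrow> b' = b \<and> d' = d"
    using bd' bd \<open>0 < e\<close> by (auto simp: I Ico_eq_Ico)
  have "({b..d - e} \<subseteq> interior I) = (b' < b \<and> d - e < d')"
    "({b + e..d} \<subseteq> interior I) = (b' < b + e \<and> d < d')"
    "({b + e..d - e} \<subseteq> interior I) = (b' < b + e \<and> d - e < d')"
    "({b..d} \<subseteq> interior I) = (b' < b \<and> d < d')"
    using bd \<open>0 < e\<close> by (auto simp: I subset_iff)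
  then show ?case
    using IH gap \<open>0 < e\<close> by (auto simp: barcode_rank_def eq)
qed

lemma finite_positive_gap:
  fixes A :: "real set"
  assumes "finite A"
  shows "\<exists>e>0. \<forall>x\<in>A. x \<le> 0 \<or> e \<le> x"
proof -
  let ?e = "Min (insert 1 {x\<in>A. 0 < x})"
  have "0 < ?e" using assms by simp
  moreover have "?e \<le> x" if "x \<in> A" "0 < x" for x
    using assms that by (intro Min_le) auto
  ultimately show ?thesis by (meson not_le)
qed

text \<open>
  Both barcodes are finite, so one shift \<open>e\<close> satisfies the gap hypotheses of \<open>count_rank\<close> for
  both of them.
\<close>

lemma barcode_eq_if_rank_eq:
  assumes B: "B \<in> barcodes" and C: "C \<in> barcodes"
    and eq: "\<And>s t. s \<le> t \<Longrightarrow> barcode_rank B s t = barcode_rank C s t"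
  shows "B = C"
proof (rule multiset_eqI)
  fix I
  show "count B I = count C I"
  proof (cases "I \<in> Int_bco")
    case True
    then obtain b d where I: "I = {b..<d}" and bd: "b < d" by (auto simp: Int_bco_def)
    \<comment> \<open>The entry \<open>(d - b) / 2\<close> of the list of gaps keeps the two shifted endpoints in order.\<close>
    let ?S = "set_mset B \<union> set_mset C"
    obtain e where e: "0 < e" and
      gap: "\<forall>x\<in>insert ((d - b) / 2) ((\<lambda>I. Inf I - b) ` ?S \<union> (\<lambda>I. d - Sup I) ` ?S). x \<le> 0 \<or> e \<le> x"
      using finite_positive_gap[of
          "insert ((d - b) / 2) ((\<lambda>I. Inf I - b) ` ?S \<union> (\<lambda>I. d - Sup I) ` ?S)"]
      by auto
    have ebd: "b + e \<le> d - e" using gap bd by auto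
    have inf: "Inf I \<le> b \<or> b + e \<le> Inf I" and sup: "Sup I \<le> d - e \<or> d \<le> Sup I"
      if "I \<in> ?S" for I
    proof -
      have "Inf I - b \<le> 0 \<or> e \<le> Inf I - b" "d - Sup I \<le> 0 \<or> e \<le> d - Sup I"
        using gap that by blast+
      then show "Inf I \<le> b \<or> b + e \<le> Inf I" "Sup I \<le> d - e \<or> d \<le> Sup I" by auto
    qed
    have "count A I + barcode_rank A b (d - e) + barcode_rank A (b + e) d
        = barcode_rank A (b + e) (d - e) + barcode_rank A b d"
      if "A \<in> {B, C}" for A
      unfolding I using that B C inf sup by (intro count_rank e ebd) auto
    from this[of B] this[of C] show ?thesis
      using eq[of b d] eq[of b "d - e"] eq[of "b + e" d] eq[of "b + e" "d - e"] e ebd by simp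
  next
    case False
    then have "I \<notin># B" "I \<notin># C" using B C by (auto simp: barcodes_def)
    then show ?thesis by (simp add: not_in_iff)
  qed
qed

lemma landscape_eq_if_AE_eq:
  assumes B: "B \<in> barcodes" and C: "C \<in> barcodes"
    and ae: "AE x in landscape_measure. landscape B x = landscape C x"
    and k: "1 \<le> k"
  shows "landscape B (k, t) = landscape C (k, t)"
proof -
  interpret P: pair_sigma_finite "count_space {1::nat..}" "lborel :: real measure"
    by (intro pair_sigma_finite.intro sigma_finite_measure_count_space_countable
        sigma_finite_lborel) auto
  have "AE t in lborel. landscape B (k, t) = landscape C (k, t)"
    using P.AE_pair[OF ae[unfolded landscape_measure_def]] k by (simp add: AE_count_space)
  then have "AE t in lebesgue. t \<in> {t. landscape B (k, t) = landscape C (k, t)}"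
    by (intro AE_completion) simp
  moreover have "closed {t. landscape B (k, t) = landscape C (k, t)}"
    by (intro closed_Collect_eq continuous_landscape B C k)
  ultimately have "t \<in> {t. landscape B (k, t) = landscape C (k, t)}"
    by (rule mem_closed_if_AE_lebesgue[rotated])
  then show ?thesis by simp
qed

lemma inj_landscape: "inj_on (\<lambda>B. ae_class landscape_measure (landscape B)) barcodes"
proof (rule inj_onI)
  fix B C
  assume B: "B \<in> barcodes" and C: "C \<in> barcodes"
    and eq: "ae_class landscape_measure (landscape B) = ae_class landscape_measure (landscape C)"
  have "landscape B \<in> ae_class landscape_measure (landscape C)"
    unfolding eq[symmetric] by (simp add: ae_class_def measurable_landscape B)
  then have "AE x in landscape_measure. landscape B x = landscape C x"
    by (simp add: ae_class_def)
  then show "B = C"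
    using B C by (intro barcode_eq_if_rank_eq rank_eq_if_landscape_eq landscape_eq_if_AE_eq)
qed

theorem theorem3p5:
  fixes p :: ennreal
  assumes "1 \<le> p"
  shows "(\<forall>B\<in>barcodes. landscape B \<in> Lp_functions p landscape_measure) \<and>
    inj_on (\<lambda>B. ae_class landscape_measure (landscape B)) barcodes \<and>
    (\<forall>B\<in>barcodes. \<forall>B'\<in>barcodes.
      Lp_norm p landscape_measure (\<lambda>x. ennreal \<bar>landscape B x - landscape B' x\<bar>)
        \<le> wasserstein p B B')"
  using landscape_in_Lp[OF assms] inj_landscape landscape_lipschitz_wasserstein[OF assms] by blast

end
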